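(* Let $\boldsymbol{\mathcal M}=\langle\mathcal S,\mathcal A,\mathbf P,\boldsymbol{\mathcal R},\mu,\gamma\rangle$ be a multi-objective Markov decision process with $d$ objectives and let $\Pi$ be a policy class. For a given oracle tolerance $\tau>0$ and referent $\boldsymbol r\in\mathbb{R}^d$, define a constrained MDP $\mathcal M_{\mathrm{const}}$ with the same states, actions, transition function, discount factor and initial state distribution as $\boldsymbol{\mathcal M}$, with $d$ cost functions equal to the $d$ components of $\boldsymbol{\mathcal R}$ with limits given by the components of $\boldsymbol r+\tau$, and with scalar reward function equal to the sum of the components of $\boldsymbol{\mathcal R}$. Then $$\Omega^\tau(\boldsymbol r)=\arg\max_{\pi\in\Pi_C}v^\pi$$ is a valid approximate Pareto oracle, where $v^\pi$ is the expected discounted return of $\pi$ for the scalar reward of $\mathcal M_{\mathrm{const}}$ and $\Pi_C\subseteq\Pi$ is the set of policies feasible for $\mathcal M_{\mathrm{const}}$.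
   Context: Orders on $\mathbb{R}^d$: $\boldsymbol v\succeq\boldsymbol v'$ means $v_j\ge v'_j$ for all $j$; $\boldsymbol v\succ\boldsymbol v'$ means $\boldsymbol v\succeq\boldsymbol v'$ and $\boldsymbol v\ne\boldsymbol v'$. For a scalar $\tau$, $\boldsymbol r+\tau$ adds $\tau$ to every coordinate. A multi-objective Markov decision process $\langle\mathcal S,\mathcal A,\mathbf P,\boldsymbol{\mathcal R},\mu,\gamma\rangle$ has states $\mathcal S$, actions $\mathcal A$, transition function $\mathbf P$, vector reward $\boldsymbol{\mathcal R}:\mathcal S\times\mathcal A\times\mathcal S\to\mathbb{R}^d$ ($d\ge2$), initial state distribution $\mu$ and discount factor $\gamma$; $\boldsymbol v^\pi=\mathbb{E}_{\pi,\mu}\bigl[\sum_{t\ge0}\gamma^t\boldsymbol{\mathcal R}(s_t,a_t,s_{t+1})\bigr]$. A policy $\pi\in\Pi$ is Pareto optimal if no $\pi'\in\Pi$ has $\boldsymbol v^{\pi'}\succ\boldsymbol v^\pi$. A constrained MDP is an MDP with scalar reward together with $m$ auxiliary cost functions $C_j:\mathcal S\times\mathcal A\times\mathcal S\to\mathbb{R}$ and limits $c_j$; with $J_{C_j}(\pi)$ the expected discounted return of $\pi$ for $C_j$, the feasible policies are $\Pi_C=\{\pi\in\Pi\mid\forall j,\ J_{C_j}(\pi)\ge c_j\}$, and the problem is to find $\pi^\ast\in\arg\max_{\pi\in\Pi_C}v^\pi$. An approximate Pareto oracle with intrinsic tolerance $\bar\tau\ge0$ and user tolerance $\tau>\bar\tau$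 maps a referent $\boldsymbol r$ to a Pareto optimal policy $\pi\in\Pi$ with $\boldsymbol v^\pi\succeq\boldsymbol r+\tau$, or returns FALSE when no such policy exists. Here the intrinsic tolerance is $\bar\tau=0$; the oracle returns any maximiser, and FALSE if $\Pi_C=\emptyset$; the maximum is taken to be attained when $\Pi_C\neq\emptyset$. *)

theory Defs
  imports "HOL-Probability.Probability"
begin

section \<open>Markov decision processes with rewards in a normed vector space\<close>

text \<open>
  The reward type is \<open>real\<close> for an ordinary MDP and \<open>real ^ 'd\<close> for a multi-objective
  one. States and actions carry arbitrary measurable structures; the countable case is
  \<^const>\<open>count_space\<close>.
\<close>

record ('s, 'a, 'r) mdp =
  states     :: "'s measure"
  actions    :: "'a measure"
  transition :: "'s \<times> 'a \<Rightarrow> 's measure"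
  reward     :: "'s \<times> 'a \<times> 's \<Rightarrow> 'r"
  init_dist  :: "'s measure"
  discount   :: real

abbreviation step_space :: "('s, 'a, 'r, 'z) mdp_scheme \<Rightarrow> ('s \<times> 'a) measure" where
  "step_space M \<equiv> states M \<Otimes>\<^sub>M actions M"

text \<open>
  \<open>discount M = 1\<close> is not excluded: existence of the discounted return is a separate
  condition (\<open>return_exists\<close> below), automatic for bounded rewards and
  \<open>discount M < 1\<close> (lemma \<open>return_exists_bounded\<close>).
\<close>

definition is_mdp :: "('s, 'a, 'r::topological_space, 'z) mdp_scheme \<Rightarrow> bool" where
  "is_mdp M \<longleftrightarrow>
     transition M \<in> step_space M \<rightarrow>\<^sub>M prob_algebra (states M) \<and>
     reward M \<in> states M \<Otimes>\<^sub>M actions M \<Otimes>\<^sub>M states M \<rightarrow>\<^sub>M borel \<and>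
     init_dist M \<in> space (prob_algebra (states M)) \<and>
     0 \<le> discount M \<and> discount M \<le> 1"

definition is_momdp :: "('s, 'a, real ^ 'd, 'z) mdp_scheme \<Rightarrow> bool" where
  "is_momdp M \<longleftrightarrow> is_mdp M \<and> 2 \<le> CARD('d)"


section \<open>Policies and expected discounted returns\<close>

text \<open>
  A policy may be randomised and depend on the whole past: \<open>\<pi> t (h, s)\<close> is the
  distribution of the action at time \<open>t\<close> in state \<open>s\<close> after the history \<open>h\<close>, where
  \<open>h i\<close> is the state-action pair at time \<open>i < t\<close>. Smaller policy classes
  (stationary, memoryless, deterministic, \<open>\<dots>\<close>) are subsets of \<open>policies M\<close>.
\<close>

type_synonym ('s, 'a) policy = "nat \<Rightarrow> (nat \<Rightarrow> 's \<times> 'a) \<times> 's \<Rightarrow> 'a measure"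

definition policies :: "('s, 'a, 'r, 'z) mdp_scheme \<Rightarrow> ('s, 'a) policy set" where
  "policies M =
     {\<pi>. \<forall>t. \<pi> t \<in> (\<Pi>\<^sub>M i\<in>{0..<t}. step_space M) \<Otimes>\<^sub>M states M \<rightarrow>\<^sub>M prob_algebra (actions M)}"

definition next_state ::
  "('s, 'a, 'r, 'z) mdp_scheme \<Rightarrow> nat \<Rightarrow> (nat \<Rightarrow> 's \<times> 'a) \<Rightarrow> 's measure" where
  "next_state M t h = (case t of 0 \<Rightarrow> init_dist M | Suc n \<Rightarrow> transition M (h n))"

definition step_kernel ::
  "('s, 'a, 'r, 'z) mdp_scheme \<Rightarrow> ('s, 'a) policy \<Rightarrow> nat \<Rightarrow> (nat \<Rightarrow> 's \<times> 'a) \<Rightarrow> ('s \<times> 'a) measure"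
where
  "step_kernel M \<pi> t h =
     next_state M t h \<bind> (\<lambda>s. \<pi> t (h, s) \<bind> (\<lambda>a. return (step_space M) (s, a)))"

text \<open>
  The law of the sequence of state-action pairs: the measure that the theorem of Ionescu
  Tulcea provides for the kernels above.
\<close>

definition trajectory ::
  "('s, 'a, 'r, 'z) mdp_scheme \<Rightarrow> ('s, 'a) policy \<Rightarrow> (nat \<Rightarrow> 's \<times> 'a) measure" where
  "trajectory M \<pi> =
     projective_family.lim UNIV
       (Ionescu_Tulcea.CI (step_kernel M \<pi>) (\<lambda>_. step_space M)) (\<lambda>_. step_space M)"

text \<open>
  The function \<open>f\<close> is a parameter, rather than \<open>reward M\<close>, since returns of cost
  functions are needed as well.
\<close>

definition discounted_term ::
  "('s, 'a, 'r, 'z) mdp_scheme \<Rightarrow> ('s \<times> 'a \<times> 's \<Rightarrow> 'b::real_vector) \<Rightarrow>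
   (nat \<Rightarrow> 's \<times> 'a) \<Rightarrow> nat \<Rightarrow> 'b" where
  "discounted_term M f \<omega> t =
     discount M ^ t *\<^sub>R f (fst (\<omega> t), snd (\<omega> t), fst (\<omega> (Suc t)))"

definition expected_return ::
  "('s, 'a, 'r, 'z) mdp_scheme \<Rightarrow> ('s \<times> 'a \<times> 's \<Rightarrow> 'b::{banach, second_countable_topology}) \<Rightarrow>
   ('s, 'a) policy \<Rightarrow> 'b" where
  "expected_return M f \<pi> = (\<integral>\<omega>. (\<Sum>t. discounted_term M f \<omega> t) \<partial>trajectory M \<pi>)"

text \<open>
  The expectation above is an honest one only under this condition; otherwise
  \<^const>\<open>suminf\<close> and the integral take junk values.
\<close>

definition return_exists ::
  "('s, 'a, 'r, 'z) mdp_scheme \<Rightarrow> ('s \<times> 'a \<times> 's \<Rightarrow> 'b::{banach, second_countable_topology}) \<Rightarrow>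
   ('s, 'a) policy \<Rightarrow> bool" where
  "return_exists M f \<pi> \<longleftrightarrow>
     (AE \<omega> in trajectory M \<pi>. summable (discounted_term M f \<omega>)) \<and>
     integrable (trajectory M \<pi>) (\<lambda>\<omega>. \<Sum>t. discounted_term M f \<omega> t)"

lemma measurable_next_state: assumes "is_mdp M"
 shows "next_state M t \<in> (\<Pi>\<^sub>M i\<in>{0..<t}. step_space M) \<rightarrow>\<^sub>M prob_algebra (states M)"
proof (cases t)
  case 0
  have "init_dist M \<in> space (prob_algebra (states M))" using assms by (simp add: is_mdp_def)
  then show ?thesis unfolding 0 next_state_def[abs_def] nat.case by (rule measurable_const)
next
  case (Suc n)
  have [measurable]: "transition M \<in> step_space M \<rightarrow>\<^sub>M prob_algebra (states M)" using assms by (simp add: is_mdp_def)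
  show ?thesis unfolding Suc next_state_def[abs_def] nat.case
    by (rule measurable_compose[OF measurable_component_singleton]) auto
qed

lemma measurable_step_kernel: assumes "is_mdp M" "\<pi> \<in> policies M"
 shows "step_kernel M \<pi> t \<in> (\<Pi>\<^sub>M i\<in>{0..<t}. step_space M) \<rightarrow>\<^sub>M prob_algebra (step_space M)"
proof -
  note [measurable] = measurable_next_state[OF assms(1)]
  have [measurable]: "\<pi> t \<in> (\<Pi>\<^sub>M i\<in>{0..<t}. step_space M) \<Otimes>\<^sub>M states M \<rightarrow>\<^sub>M prob_algebra (actions M)"
    using assms by (simp add: policies_def)
  show ?thesis unfolding step_kernel_def[abs_def]
    by measurable
qed

lemma Ionescu_Tulcea_step_kernel: assumes "is_mdp M" "\<pi> \<in> policies M"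
 shows "Ionescu_Tulcea (step_kernel M \<pi>) (\<lambda>_. step_space M)"
  apply (rule Ionescu_Tulcea.intro)
  subgoal using measurable_step_kernel[OF assms] by (rule measurable_prob_algebraD)
  subgoal for i x using measurable_space[OF measurable_step_kernel[OF assms], of x i] by (auto simp: space_prob_algebra)
  done

lemma sets_trajectory: assumes "is_mdp M" "\<pi> \<in> policies M" shows "sets (trajectory M \<pi>) = sets (\<Pi>\<^sub>M i\<in>UNIV. step_space M)"
proof -
  interpret I: Ionescu_Tulcea "step_kernel M \<pi>" "\<lambda>_. step_space M" using Ionescu_Tulcea_step_kernel[OF assms] .
  show ?thesis by (simp add: trajectory_def)
qed

lemma prob_space_trajectory: assumes "is_mdp M" "\<pi> \<in> policies M" shows "prob_space (trajectory M \<pi>)"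
  and distr_trajectory: "finite J \<Longrightarrow> distr (trajectory M \<pi>) (\<Pi>\<^sub>M i\<in>J. step_space M) (\<lambda>\<omega>. restrict \<omega> J)
     = Ionescu_Tulcea.CI (step_kernel M \<pi>) (\<lambda>_. step_space M) J"
proof -
  interpret I: Ionescu_Tulcea "step_kernel M \<pi>" "\<lambda>_. step_space M" using Ionescu_Tulcea_step_kernel[OF assms] .
  have 1: "trajectory M \<pi> = I.PF.lim" by (simp add: trajectory_def)
  show d: "finite J \<Longrightarrow> distr (trajectory M \<pi>) (\<Pi>\<^sub>M i\<in>J. step_space M) (\<lambda>\<omega>. restrict \<omega> J)
     = I.CI J" for J unfolding 1 by (rule I.distr_lim)
  have m: "(\<lambda>\<omega>. restrict \<omega> {}) \<in> trajectory M \<pi> \<rightarrow>\<^sub>M (\<Pi>\<^sub>M i\<in>{}. step_space M)"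
    unfolding measurable_cong_sets[OF sets_trajectory[OF assms] refl] by (intro measurable_restrict_subset) simp
  have "prob_space (distr (trajectory M \<pi>) (\<Pi>\<^sub>M i\<in>{}. step_space M) (\<lambda>\<omega>. restrict \<omega> {}))"
    unfolding d[OF finite.emptyI] by (rule I.PF.prob_space_P) simp_all
  then show "prob_space (trajectory M \<pi>)" using m prob_space_distrD by blast
qed

lemma return_exists_bounded:
  fixes f :: "'s \<times> 'a \<times> 's \<Rightarrow> 'b::{banach, second_countable_topology}"
  assumes "is_mdp M" "\<pi> \<in> policies M" "discount M < 1"
    and [measurable]: "f \<in> states M \<Otimes>\<^sub>M actions M \<Otimes>\<^sub>M states M \<rightarrow>\<^sub>M borel"
    and B: "\<And>x. x \<in> space (states M \<Otimes>\<^sub>M actions M \<Otimes>\<^sub>M states M) \<Longrightarrow> norm (f x) \<le> B"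
  shows "return_exists M f \<pi>"
proof -
  interpret prob_space "trajectory M \<pi>" using prob_space_trajectory[OF assms(1,2)] by simp
  note [measurable_cong] = sets_trajectory[OF assms(1,2)]
  have g: "0 \<le> discount M" using assms(1) by (simp add: is_mdp_def)
  have sp: "space (trajectory M \<pi>) = space (\<Pi>\<^sub>M i\<in>UNIV. step_space M)" by (rule sets_eq_imp_space_eq[OF sets_trajectory[OF assms(1,2)]])
  have b: "norm (discounted_term M f \<omega> t) \<le> B * discount M ^ t" if "\<omega> \<in> space (trajectory M \<pi>)" for \<omega> t
  proof -
    have "\<omega> i \<in> space (step_space M)" for i using that unfolding sp by (auto simp: space_PiM)
    then have "(fst (\<omega> t), snd (\<omega> t), fst (\<omega> (Suc t))) \<in> space (states M \<Otimes>\<^sub>M actions M \<Otimes>\<^sub>M states M)"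
      by (simp add: space_pair_measure mem_Times_iff)
    from B[OF this] g show ?thesis by (simp add: discounted_term_def mult.commute[of B] mult_left_mono)
  qed
  have sg: "summable (\<lambda>t. B * discount M ^ t)" using g assms(3) by (intro summable_mult summable_geometric) simp
  have s: "summable (\<lambda>t. norm (discounted_term M f \<omega> t))" if "\<omega> \<in> space (trajectory M \<pi>)" for \<omega>
    by (rule summable_comparison_test[OF _ sg]) (use b[OF that] in auto)
  have m[measurable]: "(\<lambda>\<omega>. discounted_term M f \<omega> t) \<in> borel_measurable (trajectory M \<pi>)" for t
    unfolding discounted_term_def by measurable
  have "integrable (trajectory M \<pi>) (\<lambda>\<omega>. \<Sum>t. discounted_term M f \<omega> t)"
  proof (rule integrable_const_bound[where B="\<Sum>t. B * discount M ^ t"])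
    show "AE \<omega> in trajectory M \<pi>. norm (\<Sum>t. discounted_term M f \<omega> t) \<le> (\<Sum>t. B * discount M ^ t)"
    proof (rule AE_I2)
      fix \<omega> assume w: "\<omega> \<in> space (trajectory M \<pi>)"
      have "norm (\<Sum>t. discounted_term M f \<omega> t) \<le> (\<Sum>t. norm (discounted_term M f \<omega> t))" using s[OF w] by (rule summable_norm)
      also have "\<dots> \<le> (\<Sum>t. B * discount M ^ t)" using b[OF w] s[OF w] sg by (intro suminf_le) auto
      finally show "norm (\<Sum>t. discounted_term M f \<omega> t) \<le> (\<Sum>t. B * discount M ^ t)" .
    qed
  qed measurable
  moreover have "AE \<omega> in trajectory M \<pi>. summable (discounted_term M f \<omega>)"
    using s summable_norm_cancel by (intro AE_I2) blast
  ultimately show ?thesis unfolding return_exists_def by simp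
qed

abbreviation policy_value ::
  "('s, 'a, 'r::{banach, second_countable_topology}, 'z) mdp_scheme \<Rightarrow> ('s, 'a) policy \<Rightarrow> 'r" where
  "policy_value M \<pi> \<equiv> expected_return M (reward M) \<pi>"


section \<open>Pareto optimality and approximate Pareto oracles\<close>

text \<open>The library order on vectors is the coordinatewise one.\<close>

definition pareto_dominates :: "real ^ 'd \<Rightarrow> real ^ 'd \<Rightarrow> bool" (infix \<open>\<succ>\<^sub>P\<close> 50) where
  "v \<succ>\<^sub>P w \<longleftrightarrow> v \<ge> w \<and> v \<noteq> w"

definition pareto_optimal ::
  "('s, 'a, real ^ 'd, 'z) mdp_scheme \<Rightarrow> ('s, 'a) policy set \<Rightarrow> ('s, 'a) policy \<Rightarrow> bool" where
  "pareto_optimal M Pol \<pi> \<longleftrightarrow>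
     \<pi> \<in> Pol \<and> \<not> (\<exists>\<pi>'\<in>Pol. policy_value M \<pi>' \<succ>\<^sub>P policy_value M \<pi>)"

text \<open>\<open>None\<close> is the answer FALSE.\<close>

definition approx_pareto_oracle ::
  "('s, 'a, real ^ 'd, 'z) mdp_scheme \<Rightarrow> ('s, 'a) policy set \<Rightarrow> real \<Rightarrow> real \<Rightarrow>
   (real ^ 'd \<Rightarrow> ('s, 'a) policy option) \<Rightarrow> bool" where
  "approx_pareto_oracle M Pol \<tau>\<^sub>0 \<tau> \<Omega> \<longleftrightarrow>
     0 \<le> \<tau>\<^sub>0 \<and> \<tau>\<^sub>0 < \<tau> \<and>
     (\<forall>r. case \<Omega> r of
            Some \<pi> \<Rightarrow> pareto_optimal M Pol \<pi> \<and> policy_value M \<pi> \<ge> r + vec \<tau>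
          | None \<Rightarrow> \<not> (\<exists>\<pi>. pareto_optimal M Pol \<pi> \<and> policy_value M \<pi> \<ge> r + vec \<tau>))"


section \<open>Constrained Markov decision processes\<close>

record ('s, 'a, 'm) cmdp = "('s, 'a, real) mdp" +
  costs  :: "'m \<Rightarrow> 's \<times> 'a \<times> 's \<Rightarrow> real"
  limits :: "'m \<Rightarrow> real"

definition feasible ::
  "('s, 'a, 'm, 'z) cmdp_scheme \<Rightarrow> ('s, 'a) policy set \<Rightarrow> ('s, 'a) policy set" where
  "feasible C Pol = {\<pi>\<in>Pol. \<forall>j. expected_return C (costs C j) \<pi> \<ge> limits C j}"

definition cmdp_argmax ::
  "('s, 'a, 'm, 'z) cmdp_scheme \<Rightarrow> ('s, 'a) policy set \<Rightarrow> ('s, 'a) policy set" where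
  "cmdp_argmax C Pol = {\<pi>. is_arg_max (policy_value C) (\<lambda>\<pi>. \<pi> \<in> feasible C Pol) \<pi>}"

text \<open>
  A possible answer of a solver that returns any maximiser, or \<open>None\<close> if the problem is
  infeasible. Nothing is required of it if the problem is feasible but has no maximiser.
\<close>

definition cmdp_answer ::
  "('s, 'a, 'm, 'z) cmdp_scheme \<Rightarrow> ('s, 'a) policy set \<Rightarrow> ('s, 'a) policy option \<Rightarrow> bool" where
  "cmdp_answer C Pol x \<longleftrightarrow>
     (feasible C Pol = {} \<longrightarrow> x = None) \<and>
     (cmdp_argmax C Pol \<noteq> {} \<longrightarrow> x \<in> Some ` cmdp_argmax C Pol)"

definition const_cmdp ::
  "('s, 'a, real ^ 'd) mdp \<Rightarrow> real \<Rightarrow> real ^ 'd \<Rightarrow> ('s, 'a, 'd) cmdp" where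
  "const_cmdp M \<tau> r =
     \<lparr> states = states M, actions = actions M, transition = transition M,
       reward = (\<lambda>x. \<Sum>j\<in>UNIV. reward M x $ j),
       init_dist = init_dist M, discount = discount M,
       costs = (\<lambda>j x. reward M x $ j),
       limits = (\<lambda>j. (r + vec \<tau>) $ j) \<rparr>"

end

theory Submission
  imports Defs
begin

text \<open>
  The discounted return is linear in the reward, so the return of each cost function is a
  coordinate of the vector return, and the scalar return is the sum of its coordinates. A
  feasible policy that were dominated would be dominated by a policy that is again feasible and
  has a strictly larger coordinate sum; hence a maximiser is Pareto optimal.
\<close>

lemma measurable_discounted_term:
  fixes f :: "'s \<times> 'a \<times> 's \<Rightarrow> 'b::{banach, second_countable_topology}"
  assumes "is_mdp M" "\<pi> \<in> policies M"
    and [measurable]: "f \<in> states M \<Otimes>\<^sub>M actions M \<Otimes>\<^sub>M states M \<rightarrow>\<^sub>M borel"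
  shows "(\<lambda>\<omega>. discounted_term M f \<omega> t) \<in> borel_measurable (trajectory M \<pi>)"
proof -
  note [measurable_cong] = sets_trajectory[OF assms(1,2)]
  show ?thesis unfolding discounted_term_def by measurable
qed

text \<open>A bounded linear map commutes with convergent series and with the Bochner integral of an
  integrable function. \<open>return_exists\<close> supplies both conditions; without it
  \<open>suminf\<close> and the integral could be default values that \<open>T\<close> need not
  respect.\<close>

lemma expected_return_bounded_linear:
  fixes f :: "'s \<times> 'a \<times> 's \<Rightarrow> 'b::{banach, second_countable_topology}"
    and T :: "'b \<Rightarrow> 'c::{banach, second_countable_topology}"
  assumes "is_mdp M" "\<pi> \<in> policies M"
    and "f \<in> states M \<Otimes>\<^sub>M actions M \<Otimes>\<^sub>M states M \<rightarrow>\<^sub>M borel"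
    and T: "bounded_linear T" and ex: "return_exists M f \<pi>"
  shows "expected_return M (\<lambda>x. T (f x)) \<pi> = T (expected_return M f \<pi>)"
proof -
  have summ: "AE \<omega> in trajectory M \<pi>. summable (discounted_term M f \<omega>)"
    and int: "integrable (trajectory M \<pi>) (\<lambda>\<omega>. \<Sum>t. discounted_term M f \<omega> t)"
    using ex by (auto simp: return_exists_def)
  have T_term: "discounted_term M (\<lambda>x. T (f x)) \<omega> t = T (discounted_term M f \<omega> t)" for \<omega> t
    by (simp add: discounted_term_def linear_simps[OF T])
  have [measurable]: "T \<in> borel_measurable borel"
    using T by (intro borel_measurable_continuous_onI linear_continuous_on)
  note [measurable] = measurable_discounted_term[OF assms(1-3)]
  have "expected_return M (\<lambda>x. T (f x)) \<pi>
      = (\<integral>\<omega>. (\<Sum>t. T (discounted_term M f \<omega> t)) \<partial>trajectory M \<pi>)"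
    by (simp add: expected_return_def T_term)
  \<comment> \<open>\<open>T\<close> can be pulled out of the series only where the series
    converges, that is almost everywhere. Passing to the integral through
    \<open>integral_cong_AE\<close> also requires both integrands to be measurable, hence the two
    measurability facts above.\<close>
  also have "\<dots> = (\<integral>\<omega>. T (\<Sum>t. discounted_term M f \<omega> t) \<partial>trajectory M \<pi>)"
    using summ by (intro integral_cong_AE) (auto simp: bounded_linear.suminf[OF T])
  also have "\<dots> = T (expected_return M f \<pi>)"
    unfolding expected_return_def by (rule integral_bounded_linear[OF T int])
  finally show ?thesis .
qed

text \<open>A return depends on the process only through the trajectory law and the discount factor,
  and \<open>const_cmdp\<close> copies everything that determines these.\<close>

lemma expected_return_const_cmdp:
  "expected_return (const_cmdp M \<tau> r) f \<pi> = expected_return M f \<pi>"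
proof -
  have "step_kernel (const_cmdp M \<tau> r) \<pi> = step_kernel M \<pi>"
    by (intro ext) (simp add: step_kernel_def next_state_def const_cmdp_def split: nat.split)
  then have "trajectory (const_cmdp M \<tau> r) \<pi> = trajectory M \<pi>"
    by (simp add: trajectory_def const_cmdp_def)
  then show ?thesis
    by (simp add: expected_return_def discounted_term_def const_cmdp_def)
qed

context
  fixes M :: "('s, 'a, real ^ 'd) mdp" and Pol :: "('s, 'a) policy set"
  assumes mdp: "is_mdp M" and Pol: "Pol \<subseteq> policies M"
    and ex: "\<And>\<pi>. \<pi> \<in> Pol \<Longrightarrow> return_exists M (reward M) \<pi>"
begin

text \<open>Applied below with \<open>T\<close> a coordinate projection, for the costs, and with
  \<open>T\<close> the coordinate sum, for the scalar reward.\<close>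

lemma expected_return_linear_reward:
  fixes T :: "real ^ 'd \<Rightarrow> real"
  assumes "\<pi> \<in> Pol" "bounded_linear T"
  shows "expected_return M (\<lambda>x. T (reward M x)) \<pi> = T (policy_value M \<pi>)"
  using assms mdp Pol ex by (intro expected_return_bounded_linear) (auto simp: is_mdp_def)

lemma feasible_const_cmdp:
  "feasible (const_cmdp M \<tau> r) Pol = {\<pi>\<in>Pol. policy_value M \<pi> \<ge> r + vec \<tau>}"
proof -
  have "limits (const_cmdp M \<tau> r) j = (r + vec \<tau>) $ j"
    and "costs (const_cmdp M \<tau> r) j = (\<lambda>x. reward M x $ j)" for j
    by (simp_all add: const_cmdp_def)
  then show ?thesis
    by (auto simp: feasible_def expected_return_const_cmdp less_eq_vec_def
        expected_return_linear_reward[OF _ bounded_linear_vec_nth])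
qed

lemma policy_value_const_cmdp:
  assumes "\<pi> \<in> Pol"
  shows "policy_value (const_cmdp M \<tau> r) \<pi> = (\<Sum>j\<in>UNIV. policy_value M \<pi> $ j)"
proof -
  have "reward (const_cmdp M \<tau> r) = (\<lambda>x. \<Sum>j\<in>UNIV. reward M x $ j)"
    by (simp add: const_cmdp_def)
  then show ?thesis
    using expected_return_linear_reward[OF assms, of "\<lambda>v. \<Sum>j\<in>UNIV. v $ j"]
    by (simp add: expected_return_const_cmdp bounded_linear_sum bounded_linear_vec_nth)
qed

lemma pareto_optimal_cmdp_argmax:
  assumes "\<pi> \<in> cmdp_argmax (const_cmdp M \<tau> r) Pol"
  shows "pareto_optimal M Pol \<pi>" and "policy_value M \<pi> \<ge> r + vec \<tau>"
proof -
  have \<pi>: "\<pi> \<in> Pol" and ge: "policy_value M \<pi> \<ge> r + vec \<tau>"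
    and max: "\<And>\<pi>'. \<pi>' \<in> feasible (const_cmdp M \<tau> r) Pol \<Longrightarrow>
      \<not> policy_value (const_cmdp M \<tau> r) \<pi> < policy_value (const_cmdp M \<tau> r) \<pi>'"
    using assms by (auto simp: cmdp_argmax_def is_arg_max_def feasible_const_cmdp)
  show "policy_value M \<pi> \<ge> r + vec \<tau>" by (fact ge)
  have False if "\<pi>' \<in> Pol" and dom: "policy_value M \<pi>' \<succ>\<^sub>P policy_value M \<pi>" for \<pi>'
  proof -
    have "policy_value M \<pi> \<le> policy_value M \<pi>'" using dom by (simp add: pareto_dominates_def)
    then have "\<pi>' \<in> feasible (const_cmdp M \<tau> r) Pol"
      using that(1) ge by (auto simp: feasible_const_cmdp intro: order_trans)
    \<comment> \<open>Dominance gives the weak inequality in every coordinate; since the two vectors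
      differ, it is strict in at least one.\<close>
    moreover have "(\<Sum>j\<in>UNIV. policy_value M \<pi> $ j) < (\<Sum>j\<in>UNIV. policy_value M \<pi>' $ j)"
      using dom by (intro sum_strict_mono_ex1)
        (auto simp: pareto_dominates_def less_eq_vec_def vec_eq_iff less_le, metis)
    ultimately show False
      using max[of \<pi>'] \<pi> that(1) by (simp add: policy_value_const_cmdp)
  qed
  then show "pareto_optimal M Pol \<pi>" using \<pi> by (auto simp: pareto_optimal_def)
qed

end

theorem propositionB4:
  fixes M :: "('s, 'a, real ^ 'd) mdp"
    and Pol :: "('s, 'a) policy set"
    and \<tau> :: real
    and \<Omega> :: "real ^ 'd \<Rightarrow> ('s, 'a) policy option"
  assumes "is_momdp M"
    and "Pol \<subseteq> policies M"
    and "\<And>\<pi>. \<pi> \<in> Pol \<Longrightarrow> return_exists M (reward M) \<pi>"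
    and "\<tau> > 0"
    and attained: "\<And>r. feasible (const_cmdp M \<tau> r) Pol \<noteq> {} \<Longrightarrow>
                         cmdp_argmax (const_cmdp M \<tau> r) Pol \<noteq> {}"
    and answers: "\<And>r. cmdp_answer (const_cmdp M \<tau> r) Pol (\<Omega> r)"
  shows "approx_pareto_oracle M Pol 0 \<tau> \<Omega>"
proof -
  have mdp: "is_mdp M" using assms(1) by (simp add: is_momdp_def)
  note opt = pareto_optimal_cmdp_argmax[OF mdp assms(2,3)]
  note feas = feasible_const_cmdp[OF mdp assms(2,3)]
  have "case \<Omega> r of
      Some \<pi> \<Rightarrow> pareto_optimal M Pol \<pi> \<and> policy_value M \<pi> \<ge> r + vec \<tau>
    | None \<Rightarrow> \<not> (\<exists>\<pi>. pareto_optimal M Pol \<pi> \<and> policy_value M \<pi> \<ge> r + vec \<tau>)" for r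
  proof (cases "\<Omega> r")
    case None
    \<comment> \<open>Were some policy feasible, \<open>attained\<close> would provide a maximiser,
      and the answer would then have to be \<open>Some\<close>.\<close>
    then have "feasible (const_cmdp M \<tau> r) Pol = {}"
      using attained[of r] answers[of r] by (auto simp: cmdp_answer_def)
    \<comment> \<open>A Pareto optimal policy above the target lies in \<open>Pol\<close>, so it
      would be feasible.\<close>
    then show ?thesis using None by (auto simp: feas pareto_optimal_def)
  next
    case (Some \<pi>)
    \<comment> \<open>\<open>cmdp_answer\<close> identifies the answer as a maximiser only once one
      is known to exist, so feasibility is derived first and \<open>attained\<close> then yields a
      maximiser.\<close>
    then have "feasible (const_cmdp M \<tau> r) Pol \<noteq> {}"
      using answers[of r] by (auto simp: cmdp_answer_def)
    then have "\<pi> \<in> cmdp_argmax (const_cmdp M \<tau> r) Pol"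
      using Some attained[of r] answers[of r] by (auto simp: cmdp_answer_def)
    then show ?thesis using Some opt by simp
  qed
  then show ?thesis using assms(4) by (simp add: approx_pareto_oracle_def)
qed

end
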